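(* For any $K\in\{0,\ldots,N\}$, any norm $\|\cdot\|$ on $\mathbb{R}^N$ and any $\tau>0$, one has $$\mathcal{I}^K(\tau)=\bigcup_{J\in\mathcal{J}(K)}\mathcal{T}_J^\tau .$$ As a consequence, $\mathcal{I}^K(\tau)$ is closed and (Lebesgue) measurable.
   Context: $N\ge 1$ is an integer, $\|\cdot\|$ is an arbitrary norm on $\mathbb{R}^N$, and $(\psi_i)_{i\in I}$ (the dictionary) is a finite family of vectors of $\mathbb{R}^N$ with $\mathrm{span}\{\psi_i:i\in I\}=\mathbb{R}^N$. For $d\in\mathbb{R}^N$ and $\tau>0$, $\mathrm{val}(\mathcal{P}_d)$ denotes the minimum of $\#\{i\in I:\lambda_i\ne 0\}$ over all $(\lambda_i)_{i\in I}\in\mathbb{R}^I$ satisfying $\left\|\sum_{i\in I}\lambda_i\psi_i-d\right\|\le\tau$ (it depends on $\tau$). Set $\mathcal{I}^K(\tau)=\{d\in\mathbb{R}^N:\mathrm{val}(\mathcal{P}_d)\le K\}$. For a function $f$, $\mathcal{L}_f(t)=\{w: f(w)\le t\}$. For a subspace $V\subset\mathbb{R}^N$, $V^\bot$ is its orthogonal complement (for the Euclidean inner product) and $P_V$ the orthogonal projection onto $V$. For $J\subset I$, $\mathcal{T}_J=\mathrm{span}((\psi_j)_{j\in J})$, with $\mathrm{span}(\emptyset)=\{0\}$, and $$\mathcal{T}_J^\tau=\mathcal{T}_J+P_{\mathcal{T}_J^\bot}\left(\mathcal{L}_{\|\cdot\|}(\tau)\right).$$ For $K\in\{0,\ldots,N\}$,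 $\mathcal{J}(K)$ is a fixed collection of subsets of $I$ such that: (a) every $J\in\mathcal{J}(K)$ satisfies $\dim\mathcal{T}_J=K$; (b) if $J_1,J_2\in\mathcal{J}(K)$ and $J_1\ne J_2$ then $\mathcal{T}_{J_1}\ne\mathcal{T}_{J_2}$; (c) for every $J_1\subset I$ with $\dim\mathcal{T}_{J_1}=K$ there is $J\in\mathcal{J}(K)$ with $\mathcal{T}_J=\mathcal{T}_{J_1}$. For $K=0$, $\mathcal{J}(0)=\{\emptyset\}$. *)

theory Defs
  imports "HOL-Analysis.Analysis"
begin

definition is_norm :: "('a::real_vector \<Rightarrow> real) \<Rightarrow> bool" where
  "is_norm nrm \<longleftrightarrow>
     (\<forall>x. 0 \<le> nrm x) \<and>
     (\<forall>x. nrm x = 0 \<longleftrightarrow> x = 0) \<and>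
     (\<forall>a x. nrm (a *\<^sub>R x) = \<bar>a\<bar> * nrm x) \<and>
     (\<forall>x y. nrm (x + y) \<le> nrm x + nrm y)"

definition level_set :: "('a \<Rightarrow> real) \<Rightarrow> real \<Rightarrow> 'a set" where
  "level_set f t = {w. f w \<le> t}"

definition orth_proj :: "'a::euclidean_space set \<Rightarrow> 'a \<Rightarrow> 'a" where
  "orth_proj V x = (THE p. p \<in> V \<and> x - p \<in> orthogonal_comp V)"

text \<open>On a subspace the description in \<^const>\<open>orth_proj\<close> is well-defined.\<close>

lemma orth_proj_ex1:
  fixes V :: "'a::euclidean_space set"
  assumes "subspace V"
  shows "\<exists>!p. p \<in> V \<and> x - p \<in> orthogonal_comp V"
proof -
  obtain y z where yz: "y \<in> span V" "\<And>w. w \<in> span V \<Longrightarrow> orthogonal z w" "x = y + z"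
    using orthogonal_subspace_decomp_exists by blast
  have V: "span V = V"
    using assms by (simp add: span_eq_iff)
  show ?thesis
  proof (rule ex1I[of _ y])
    show "y \<in> V \<and> x - y \<in> orthogonal_comp V"
      using yz V by (auto simp: orthogonal_comp_def orthogonal_commute)
  next
    fix p assume p: "p \<in> V \<and> x - p \<in> orthogonal_comp V"
    have "p - y \<in> V"
      using p yz V assms by (auto intro: subspace_diff)
    then have "orthogonal (p - y) (x - p)" "orthogonal (p - y) z"
      using p yz(2)[of "p - y"] V by (simp_all add: orthogonal_comp_def orthogonal_commute)
    then have "(p - y) \<bullet> (p - y) = 0"
      using yz(3) by (simp add: orthogonal_def inner_diff_right inner_add_right)
    then show "p = y" by simp
  qed
qed

text \<open>
  A dictionary is a family \<open>\<psi>\<close> indexed by a finite set \<open>I\<close> (repeated or zero vectors are allowed).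
  Coefficient vectors are total functions \<open>c\<close>; only their values on \<open>I\<close> matter.
\<close>

definition feasible ::
  "('a::real_vector \<Rightarrow> real) \<Rightarrow> 'i set \<Rightarrow> ('i \<Rightarrow> 'a) \<Rightarrow> real \<Rightarrow> 'a \<Rightarrow> ('i \<Rightarrow> real) \<Rightarrow> bool"
  where "feasible nrm I \<psi> \<tau> d c \<longleftrightarrow> nrm ((\<Sum>i\<in>I. c i *\<^sub>R \<psi> i) - d) \<le> \<tau>"

definition val_P ::
  "('a::real_vector \<Rightarrow> real) \<Rightarrow> 'i set \<Rightarrow> ('i \<Rightarrow> 'a) \<Rightarrow> real \<Rightarrow> 'a \<Rightarrow> nat"
  where "val_P nrm I \<psi> \<tau> d =
    (LEAST n. \<exists>c. feasible nrm I \<psi> \<tau> d c \<and> n = card {i \<in> I. c i \<noteq> 0})"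

text \<open>For a spanning dictionary the minimum exists, so the LEAST operator takes no junk value.\<close>

lemma val_P_attained:
  assumes "is_norm nrm" "finite I" "span (\<psi> ` I) = UNIV" "0 < \<tau>"
  shows "\<exists>c. feasible nrm I \<psi> \<tau> d c \<and> val_P nrm I \<psi> \<tau> d = card {i \<in> I. c i \<noteq> 0}"
proof -
  have "d \<in> span (\<psi> ` I)"
    using assms by simp
  then have "\<exists>c. d = (\<Sum>i\<in>I. c i *\<^sub>R \<psi> i)"
  proof (induction rule: span_induct_alt)
    case base
    show ?case by (rule exI[of _ "\<lambda>_. 0"]) simp
  next
    case (step a x y)
    then obtain c j where "y = (\<Sum>i\<in>I. c i *\<^sub>R \<psi> i)" "j \<in> I" "x = \<psi> j"
      by blast
    then have "a *\<^sub>R x + y = (\<Sum>i\<in>I. ((if i = j then a else 0) + c i) *\<^sub>R \<psi> i)"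
      using assms(2)
      by (simp add: scaleR_add_left sum.distrib if_distrib[of "\<lambda>r. r *\<^sub>R _"] sum.delta cong: if_cong)
    then show ?case by (rule exI[of _ "\<lambda>i. (if i = j then a else 0) + c i"])
  qed
  then obtain c where "d = (\<Sum>i\<in>I. c i *\<^sub>R \<psi> i)" by blast
  moreover have "nrm 0 = 0"
    using assms(1) by (simp add: is_norm_def)
  ultimately have "feasible nrm I \<psi> \<tau> d c"
    using assms(4) by (simp add: feasible_def)
  then have "\<exists>n c. feasible nrm I \<psi> \<tau> d c \<and> n = card {i \<in> I. c i \<noteq> 0}" by blast
  then show ?thesis
    unfolding val_P_def by (rule LeastI_ex)
qed

definition sparse_set ::
  "('a::real_vector \<Rightarrow> real) \<Rightarrow> 'i set \<Rightarrow> ('i \<Rightarrow> 'a) \<Rightarrow> nat \<Rightarrow> real \<Rightarrow> 'a set"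
  where "sparse_set nrm I \<psi> K \<tau> = {d. val_P nrm I \<psi> \<tau> d \<le> K}"

definition T_span :: "('i \<Rightarrow> 'a::real_vector) \<Rightarrow> 'i set \<Rightarrow> 'a set" where
  "T_span \<psi> J = span (\<psi> ` J)"

text \<open>The \<open>+\<close> below is the Minkowski sum of two sets.\<close>

definition T_tube ::
  "('a::euclidean_space \<Rightarrow> real) \<Rightarrow> ('i \<Rightarrow> 'a) \<Rightarrow> real \<Rightarrow> 'i set \<Rightarrow> 'a set"
  where "T_tube nrm \<psi> \<tau> J =
    T_span \<psi> J + orth_proj (orthogonal_comp (T_span \<psi> J)) ` level_set nrm \<tau>"

definition span_representatives ::
  "'i set \<Rightarrow> ('i \<Rightarrow> 'a::euclidean_space) \<Rightarrow> nat \<Rightarrow> 'i set set \<Rightarrow> bool"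
  where "span_representatives I \<psi> K \<J> \<longleftrightarrow>
    \<J> \<subseteq> Pow I \<and>
    (\<forall>J\<in>\<J>. dim (T_span \<psi> J) = K) \<and>
    (\<forall>J1\<in>\<J>. \<forall>J2\<in>\<J>. J1 \<noteq> J2 \<longrightarrow> T_span \<psi> J1 \<noteq> T_span \<psi> J2) \<and>
    (\<forall>J1\<subseteq>I. dim (T_span \<psi> J1) = K \<longrightarrow> (\<exists>J\<in>\<J>. T_span \<psi> J = T_span \<psi> J1)) \<and>
    (K = 0 \<longrightarrow> \<J> = {{}})"

end

theory Submission
  imports Defs
begin

text \<open>
  Projecting onto \<open>V\<^sup>\<bottom>\<close> changes a vector only by an element of \<open>V\<close>, so the tube around
  \<open>V = T_span \<psi> J\<close> is the Minkowski sum of \<open>V\<close> and the norm ball: the points whose \<open>nrm\<close>-distance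
  to \<open>V\<close> is at most \<open>\<tau>\<close>. A vector is \<open>K\<close>-sparsely representable iff it lies in the span of at most \<open>K\<close>
  dictionary vectors; every such span extends to a \<open>K\<close>-dimensional one, and every \<open>K\<close>-dimensional
  span has a basis of \<open>K\<close> dictionary vectors. Closedness holds because a subspace plus a compact
  ball is closed, and the union is finite.
\<close>

text \<open>The residual lies in the double orthogonal complement of \<open>V\<close>, which for a
  subspace in finite dimension is \<open>V\<close> again.\<close>

lemma orth_proj_orthogonal_comp:
  fixes V :: "'a::euclidean_space set"
  assumes "subspace V"
  shows "x - orth_proj (orthogonal_comp V) x \<in> V"
proof -
  have "orth_proj (orthogonal_comp V) x \<in> orthogonal_comp V \<and>
      x - orth_proj (orthogonal_comp V) x \<in> orthogonal_comp (orthogonal_comp V)"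
    unfolding orth_proj_def[of "orthogonal_comp V"]
    by (rule theI', rule orth_proj_ex1, rule subspace_orthogonal_comp)
  then show ?thesis
    using orthogonal_comp_self[OF assms] by simp
qed

text \<open>Each \<open>w\<close> differs from its projection by some \<open>p\<close> in
  \<open>V\<close>, and \<open>V\<close> absorbs a shift by \<open>p\<close> in either direction,
  whatever the set \<open>L\<close> is.\<close>

lemma subspace_plus_orth_proj_image:
  fixes V :: "'a::euclidean_space set"
  assumes V: "subspace V"
  shows "V + orth_proj (orthogonal_comp V) ` L = V + L"
proof (intro set_eqI iffI)
  fix d assume "d \<in> V + orth_proj (orthogonal_comp V) ` L"
  then obtain v w where vw: "v \<in> V" "w \<in> L" "d = v + orth_proj (orthogonal_comp V) w"
    by (auto elim: set_plus_elim)
  define p where "p = w - orth_proj (orthogonal_comp V) w"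
  have "p \<in> V" unfolding p_def by (rule orth_proj_orthogonal_comp[OF V])
  then have "v - p \<in> V" using vw V by (simp add: subspace_diff)
  moreover have "d = (v - p) + w" using vw by (simp add: p_def)
  ultimately show "d \<in> V + L" using vw(2) by (metis set_plus_intro)
next
  fix d assume "d \<in> V + L"
  then obtain v w where vw: "v \<in> V" "w \<in> L" "d = v + w"
    by (auto elim: set_plus_elim)
  define p where "p = w - orth_proj (orthogonal_comp V) w"
  have "p \<in> V" unfolding p_def by (rule orth_proj_orthogonal_comp[OF V])
  then have "v + p \<in> V" using vw V by (simp add: subspace_add)
  moreover have "d = (v + p) + orth_proj (orthogonal_comp V) w" using vw by (simp add: p_def)
  ultimately show "d \<in> V + orth_proj (orthogonal_comp V) ` L"
    using vw(2) by (metis set_plus_intro imageI)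
qed

lemma T_tube_eq: "T_tube nrm \<psi> \<tau> J = T_span \<psi> J + level_set nrm \<tau>"
  unfolding T_tube_def by (rule subspace_plus_orth_proj_image) (simp add: T_span_def)

lemma is_norm_minus: "is_norm nrm \<Longrightarrow> nrm (- x) = nrm x"
  unfolding is_norm_def by (metis abs_minus abs_one mult_1 scaleR_minus1_left)

text \<open>Symmetry of the norm turns the offset \<open>d - v\<close> of the Minkowski sum into the
  residual \<open>v - d\<close> that \<open>feasible\<close> measures.\<close>

lemma mem_T_tube_iff:
  assumes "is_norm nrm"
  shows "d \<in> T_tube nrm \<psi> \<tau> J \<longleftrightarrow> (\<exists>v\<in>T_span \<psi> J. nrm (v - d) \<le> \<tau>)"
proof -
  have "nrm (v - d) = nrm (d - v)" for v
    using is_norm_minus[OF assms, of "v - d"] by simp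
  moreover have "d \<in> T_tube nrm \<psi> \<tau> J \<longleftrightarrow> (\<exists>v\<in>T_span \<psi> J. d - v \<in> level_set nrm \<tau>)"
    unfolding T_tube_eq set_plus_def
    by (simp, metis add_diff_cancel_left' diff_add_cancel add.commute)
  ultimately show ?thesis by (simp add: level_set_def)
qed

text \<open>Homogeneity and the triangle inequality make \<open>nrm\<close> convex, and a finite
  convex function on an open set in finite dimension is continuous.\<close>

lemma is_norm_continuous_on:
  fixes nrm :: "'a::euclidean_space \<Rightarrow> real"
  assumes "is_norm nrm"
  shows "continuous_on UNIV nrm"
proof -
  have "convex_on UNIV nrm"
  proof (rule convex_onI)
    fix t :: real and x y :: 'a
    assume t: "0 < t" "t < 1"
    have "nrm ((1 - t) *\<^sub>R x + t *\<^sub>R y) \<le> nrm ((1 - t) *\<^sub>R x) + nrm (t *\<^sub>R y)"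
      using assms unfolding is_norm_def by blast
    also have "\<dots> = (1 - t) * nrm x + t * nrm y"
      using assms t by (simp add: is_norm_def)
    finally show "nrm ((1 - t) *\<^sub>R x + t *\<^sub>R y) \<le> (1 - t) * nrm x + t * nrm y" .
  qed simp
  then show ?thesis by (rule convex_on_continuous[OF open_UNIV])
qed

text \<open>The constant is the minimum of \<open>nrm\<close> over the Euclidean unit sphere:
  attained by compactness, positive because the minimiser is nonzero, and valid for all
  \<open>x\<close> by rescaling. It makes the balls of \<open>nrm\<close> bounded.\<close>

lemma is_norm_lower_bound:
  fixes nrm :: "'a::euclidean_space \<Rightarrow> real"
  assumes "is_norm nrm"
  obtains m where "0 < m" "\<And>x. m * norm x \<le> nrm x"
proof -
  have "compact (sphere (0::'a) 1)" "sphere (0::'a) 1 \<noteq> {}"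
    by simp_all
  moreover have "continuous_on (sphere 0 1) nrm"
    using is_norm_continuous_on[OF assms] by (rule continuous_on_subset) simp
  ultimately obtain u where u: "u \<in> sphere 0 1" "\<And>y. y \<in> sphere 0 1 \<Longrightarrow> nrm u \<le> nrm y"
    using continuous_attains_inf[of "sphere 0 1" nrm] by metis
  have "u \<noteq> 0" using u(1) by auto
  then have "nrm u \<noteq> 0" "0 \<le> nrm u" using assms by (simp_all add: is_norm_def)
  then have pos: "0 < nrm u" by simp
  have "nrm u * norm x \<le> nrm x" for x
  proof (cases "x = 0")
    case True
    then show ?thesis using assms by (simp add: is_norm_def)
  next
    case False
    then have "nrm u \<le> nrm ((1 / norm x) *\<^sub>R x)" by (intro u(2)) simp
    also have "\<dots> = nrm x / norm x"
    proof -
      have "nrm (a *\<^sub>R x) = \<bar>a\<bar> * nrm x" for a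
        using assms by (simp add: is_norm_def)
      then show ?thesis by simp
    qed
    finally show ?thesis using False by (simp add: field_simps)
  qed
  with pos show ?thesis by (rule that)
qed

lemma compact_level_set:
  fixes nrm :: "'a::euclidean_space \<Rightarrow> real"
  assumes "is_norm nrm"
  shows "compact (level_set nrm \<tau>)"
proof -
  obtain m where m: "0 < m" "\<And>x. m * norm x \<le> nrm x"
    using is_norm_lower_bound[OF assms] by blast
  have "norm x \<le> \<tau> / m" if "nrm x \<le> \<tau>" for x
    using m(1) m(2)[of x] that by (simp add: pos_le_divide_eq mult.commute)
  then have "bounded (level_set nrm \<tau>)"
    unfolding level_set_def bounded_iff by blast
  moreover have "closed (level_set nrm \<tau>)"
    unfolding level_set_def
    by (rule closed_Collect_le[OF is_norm_continuous_on[OF assms]]) simp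
  ultimately show ?thesis by (simp add: compact_eq_bounded_closed)
qed

lemma closed_T_tube:
  assumes "is_norm nrm"
  shows "closed (T_tube nrm \<psi> \<tau> J)"
proof -
  have "closed (T_span \<psi> J)" by (simp add: T_span_def closed_subspace)
  then have "closed (\<Union>x\<in>T_span \<psi> J. \<Union>y\<in>level_set nrm \<tau>. {x + y})"
    using closed_compact_sums compact_level_set[OF assms] by blast
  \<comment> \<open>The double union of singletons is the form in which
    \<open>closed_compact_sums\<close> expresses a Minkowski sum.\<close>
  moreover have "(\<Union>x\<in>T_span \<psi> J. \<Union>y\<in>level_set nrm \<tau>. {x + y}) = T_tube nrm \<psi> \<tau> J"
    unfolding T_tube_eq set_plus_def by blast
  ultimately show ?thesis by simp
qed

text \<open>Trades coefficients for spans: the support of an optimal coefficient vector serves as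
  \<open>J\<close>, and conversely the coefficients of \<open>v\<close> over \<open>J\<close>,
  extended by zero, are feasible and bound the minimum.\<close>

lemma mem_sparse_set_iff:
  assumes "is_norm nrm" "finite I" "span (\<psi> ` I) = UNIV" "0 < \<tau>"
  shows "d \<in> sparse_set nrm I \<psi> K \<tau> \<longleftrightarrow>
    (\<exists>J\<subseteq>I. card J \<le> K \<and> (\<exists>v\<in>T_span \<psi> J. nrm (v - d) \<le> \<tau>))" (is "_ \<longleftrightarrow> ?R")
proof
  assume "d \<in> sparse_set nrm I \<psi> K \<tau>"
  then obtain c where c: "feasible nrm I \<psi> \<tau> d c" "card {i \<in> I. c i \<noteq> 0} \<le> K"
    using val_P_attained[OF assms, of d] by (auto simp: sparse_set_def)
  let ?J = "{i \<in> I. c i \<noteq> 0}"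
  have "(\<Sum>i\<in>I. c i *\<^sub>R \<psi> i) = (\<Sum>i\<in>?J. c i *\<^sub>R \<psi> i)"
    by (rule sum.mono_neutral_right) (use assms in auto)
  also have "\<dots> \<in> T_span \<psi> ?J"
    unfolding T_span_def by (intro span_sum span_scale span_base) auto
  finally show ?R using c unfolding feasible_def by (intro exI[of _ ?J]) auto
next
  assume ?R
  then obtain J v where J: "J \<subseteq> I" "card J \<le> K" "v \<in> T_span \<psi> J" "nrm (v - d) \<le> \<tau>"
    by blast
  \<comment> \<open>The family may repeat vectors. Keeping one index per distinct vector lets
    coefficients attached to vectors be pulled back to indices without double counting.\<close>
  obtain B where B: "B \<subseteq> J" "inj_on \<psi> B" "\<psi> ` J = \<psi> ` B"
    by (metis subset_image_inj subset_refl)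
  have fin: "finite J" "finite B" using J(1) B(1) assms(2) by (auto intro: finite_subset)
  obtain u where u: "v = (\<Sum>x\<in>\<psi> ` B. u x *\<^sub>R x)"
    using J(3) fin(2) unfolding T_span_def B(3) by (auto simp: span_finite)
  define c where "c i = (if i \<in> B then u (\<psi> i) else 0)" for i
  have "v = (\<Sum>i\<in>B. u (\<psi> i) *\<^sub>R \<psi> i)"
    by (simp add: u sum.reindex[OF B(2)])
  also have "\<dots> = (\<Sum>i\<in>I. c i *\<^sub>R \<psi> i)"
    by (rule sum.mono_neutral_cong_left) (use assms B J in \<open>auto simp: c_def\<close>)
  finally have "feasible nrm I \<psi> \<tau> d c" using J(4) by (simp add: feasible_def)
  then have "val_P nrm I \<psi> \<tau> d \<le> card {i \<in> I. c i \<noteq> 0}"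
    unfolding val_P_def by (intro Least_le) blast
  also have "\<dots> \<le> card J"
    by (rule card_mono) (use fin B(1) in \<open>auto simp: c_def split: if_splits\<close>)
  finally show "d \<in> sparse_set nrm I \<psi> K \<tau>" using J(2) by (simp add: sparse_set_def)
qed

text \<open>A basis is chosen among the vectors indexed by \<open>J\<close>, then lifted to one
  index per basis vector, so that counting indices gives the dimension.\<close>

lemma T_span_basis:
  fixes \<psi> :: "'i \<Rightarrow> 'a::euclidean_space"
  obtains J' where "J' \<subseteq> J" "card J' = dim (T_span \<psi> J)" "T_span \<psi> J' = T_span \<psi> J"
proof -
  obtain B where B: "B \<subseteq> \<psi> ` J" "independent B" "\<psi> ` J \<subseteq> span B" "card B = dim (\<psi> ` J)"
    using basis_exists by metis
  obtain J' where J': "J' \<subseteq> J" "inj_on \<psi> J'" "B = \<psi> ` J'"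
    using B(1) by (metis subset_image_inj)
  have "span B = span (\<psi> ` J)"
    using B(1,3) span_superset[of "\<psi> ` J"] unfolding span_eq by blast
  then show ?thesis
    using that[OF J'(1)] B(4) J' by (simp add: T_span_def card_image)
qed

lemma T_span_extend:
  fixes \<psi> :: "'i \<Rightarrow> 'a::euclidean_space"
  assumes "J \<subseteq> I" "dim (T_span \<psi> J) \<le> K" "K \<le> dim (T_span \<psi> I)"
  obtains J' where "J' \<subseteq> I" "dim (T_span \<psi> J') = K" "T_span \<psi> J \<subseteq> T_span \<psi> J'"
proof -
  obtain B where B: "B \<subseteq> \<psi> ` J" "independent B" "\<psi> ` J \<subseteq> span B" "card B = dim (\<psi> ` J)"
    using basis_exists by metis
  have "B \<subseteq> \<psi> ` I" using B(1) assms(1) by blast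
  then obtain C where C: "B \<subseteq> C" "C \<subseteq> \<psi> ` I" "independent C" "\<psi> ` I \<subseteq> span C"
    using maximal_independent_subset_extend[OF _ B(2)] by metis
  have "card C = dim (\<psi> ` I)"
    using C(2,4,3) by (rule basis_card_eq_dim)
  \<comment> \<open>\<open>B\<close> has at most \<open>K\<close> elements and the dictionary basis
    \<open>C\<close> at least \<open>K\<close>, so some \<open>D\<close> between them has exactly
    \<open>K\<close>. It inherits independence from \<open>C\<close> and still spans what
    \<open>B\<close> spans.\<close>
  then obtain D where D: "B \<subseteq> D" "D \<subseteq> C" "card D = K"
    using exists_subset_between[of B K C] B(4) C assms(2,3)
    by (auto simp: T_span_def independent_imp_finite)
  obtain J' where J': "J' \<subseteq> I" "D = \<psi> ` J'"
    using D(2) C(2) by (metis subset_image_iff subset_trans)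
  have "independent D" using C(3) D(2) by (rule independent_mono)
  then have "dim (T_span \<psi> J') = K"
    using D(3) J'(2) by (simp add: T_span_def dim_eq_card_independent)
  moreover have "\<psi> ` J \<subseteq> span D" using B(3) span_mono[OF D(1)] by blast
  then have "T_span \<psi> J \<subseteq> T_span \<psi> J'"
    unfolding T_span_def J'(2) by (rule span_minimal) simp
  ultimately show ?thesis using that J'(1) by blast
qed

lemma sparse_set_eq_Union_T_tube:
  fixes nrm :: "'a::euclidean_space \<Rightarrow> real"
  assumes nrm: "is_norm nrm" and I: "finite I" "span (\<psi> ` I) = UNIV" and "0 < \<tau>"
    and \<J>: "span_representatives I \<psi> K \<J>" and K: "K \<le> DIM('a)"
  shows "sparse_set nrm I \<psi> K \<tau> = (\<Union>J\<in>\<J>. T_tube nrm \<psi> \<tau> J)"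
proof (intro set_eqI iffI)
  fix d assume "d \<in> sparse_set nrm I \<psi> K \<tau>"
  then obtain J v where J: "J \<subseteq> I" "card J \<le> K" "v \<in> T_span \<psi> J" "nrm (v - d) \<le> \<tau>"
    using mem_sparse_set_iff[OF nrm I \<open>0 < \<tau>\<close>] by blast
  have fin: "finite J" using J(1) I(1) by (rule finite_subset)
  \<comment> \<open>The span may have dimension below \<open>K\<close>, through a small
    \<open>J\<close> or dependent vectors, so it is enlarged before a representative is
    taken.\<close>
  have "dim (T_span \<psi> J) \<le> card (\<psi> ` J)"
    unfolding T_span_def dim_span by (rule dim_le_card') (simp add: fin)
  also have "\<dots> \<le> K" using card_image_le[OF fin, of \<psi>] J(2) by simp
  finally obtain J' where J': "J' \<subseteq> I" "dim (T_span \<psi> J') = K" "T_span \<psi> J \<subseteq> T_span \<psi> J'"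
    using T_span_extend[OF J(1)] K I(2) by (metis T_span_def dim_UNIV)
  then obtain J'' where "J'' \<in> \<J>" "T_span \<psi> J'' = T_span \<psi> J'"
    using \<J> unfolding span_representatives_def by metis
  then show "d \<in> (\<Union>J\<in>\<J>. T_tube nrm \<psi> \<tau> J)"
    unfolding UN_iff mem_T_tube_iff[OF nrm] using J(3,4) J'(3) by blast
next
  fix d assume "d \<in> (\<Union>J\<in>\<J>. T_tube nrm \<psi> \<tau> J)"
  then obtain J where J: "J \<in> \<J>" "\<exists>v\<in>T_span \<psi> J. nrm (v - d) \<le> \<tau>"
    by (auto simp: mem_T_tube_iff[OF nrm])
  then have "J \<subseteq> I" "dim (T_span \<psi> J) = K"
    using \<J> by (auto simp: span_representatives_def)
  \<comment> \<open>A representative may have more than \<open>K\<close> indices; a basis inside it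
    has exactly \<open>K\<close> and the same span.\<close>
  moreover obtain J' where "J' \<subseteq> J" "card J' = dim (T_span \<psi> J)" "T_span \<psi> J' = T_span \<psi> J"
    by (rule T_span_basis)
  ultimately show "d \<in> sparse_set nrm I \<psi> K \<tau>"
    unfolding mem_sparse_set_iff[OF nrm I \<open>0 < \<tau>\<close>] using J(2)
    by (intro exI[of _ J']) auto
qed

theorem theorem1:
  fixes nrm :: "real ^ 'n \<Rightarrow> real"
    and I :: "'i set"
    and \<psi> :: "'i \<Rightarrow> real ^ 'n"
    and \<J> :: "nat \<Rightarrow> 'i set set"
    and K :: nat
    and \<tau> :: real
  assumes "is_norm nrm"
    and "finite I"
    and "span (\<psi> ` I) = UNIV"
    and "\<And>k. k \<le> CARD('n) \<Longrightarrow> span_representatives I \<psi> k (\<J> k)"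
    and "K \<le> CARD('n)"
    and "0 < \<tau>"
  shows "sparse_set nrm I \<psi> K \<tau> = (\<Union>J\<in>\<J> K. T_tube nrm \<psi> \<tau> J)
    \<and> closed (sparse_set nrm I \<psi> K \<tau>)
    \<and> sparse_set nrm I \<psi> K \<tau> \<in> sets lebesgue"
proof -
  have rep: "span_representatives I \<psi> K (\<J> K)" using assms by blast
  then have eq: "sparse_set nrm I \<psi> K \<tau> = (\<Union>J\<in>\<J> K. T_tube nrm \<psi> \<tau> J)"
    using assms by (intro sparse_set_eq_Union_T_tube) simp_all
  \<comment> \<open>\<open>\<J> K\<close> consists of subsets of the finite set \<open>I\<close>, so
    the union of closed tubes is finite.\<close>
  have "finite (\<J> K)"
    using rep assms(2) by (auto simp: span_representatives_def intro: finite_subset)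
  then have closed: "closed (sparse_set nrm I \<psi> K \<tau>)"
    unfolding eq using closed_T_tube[OF assms(1)] by (intro closed_UN) auto
  moreover have "sparse_set nrm I \<psi> K \<tau> \<in> sets lebesgue"
    using borel_closed[OF closed] by simp
  ultimately show ?thesis using eq by blast
qed

end
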